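(* Let $G$ be a graph and let $\ell$ be a weakly subadditive nonnegative integer-valued function on subsets of $V(G)$ with $\ell(\emptyset)=\ell(V(G))=0$. Then $G$ is minimally $\ell$-rigid if and only if $G$ has an $\ell$-arc-connected orientation such that $d^-_G(v)=\ell(v)$ for each vertex $v$.
   Context: Graphs are finite, loopless, multiple edges allowed. $e_G(X)$ is the number of edges with both ends in $X$; $\ell(v)=\ell(\{v\})$; weakly subadditive means $\sum_{v\in A}\ell(v)\ge\ell(A)$ for all $A$. $G$ is minimally $\ell$-rigid if $e_G(X)\le\sum_{v\in X}\ell(v)-\ell(X)$ for all $X\subseteq V(G)$ and $|E(G)|=\sum_{v\in V(G)}\ell(v)-\ell(V(G))$ (equivalently, $G$ is $\ell$-rigid but no proper spanning subgraph is). In an orientation, $d^-(v)$ is the number of arcs entering $v$ and $d^-(A)$ is the number of arcs entering $A$ (tail outside $A$, head in $A$); the orientation is $\ell$-arc-connected if $d^-(A)\ge\ell(A)$ for every vertex set $A$. *)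

theory Defs
  imports "Graph_Theory.Digraph"
begin

(* Undirected multigraphs: edges are abstract objects, so parallel edges are distinct
   elements of the edge set with the same two-element set of ends. *)
record ('v, 'e) multigraph =
  vertices :: "'v set"
  edges :: "'e set"
  ends :: "'e \<Rightarrow> 'v set"

locale finite_multigraph =
  fixes G :: "('v, 'e) multigraph"
  assumes finite_vertices: "finite (vertices G)"
    and finite_edges: "finite (edges G)"
    and ends_subset: "e \<in> edges G \<Longrightarrow> ends G e \<subseteq> vertices G"
    and card_ends: "e \<in> edges G \<Longrightarrow> card (ends G e) = 2"

definition induced_edge_count :: "('v, 'e) multigraph \<Rightarrow> 'v set \<Rightarrow> nat" where
  "induced_edge_count G X = card {e \<in> edges G. ends G e \<subseteq> X}"

definition weakly_subadditive_on :: "'v set \<Rightarrow> ('v set \<Rightarrow> int) \<Rightarrow> bool" where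
  "weakly_subadditive_on V l \<longleftrightarrow> (\<forall>A\<subseteq>V. l A \<le> (\<Sum>v\<in>A. l {v}))"

definition minimally_rigid :: "('v set \<Rightarrow> int) \<Rightarrow> ('v, 'e) multigraph \<Rightarrow> bool" where
  "minimally_rigid l G \<longleftrightarrow>
     (\<forall>X\<subseteq>vertices G. int (induced_edge_count G X) \<le> (\<Sum>v\<in>X. l {v}) - l X) \<and>
     int (card (edges G)) = (\<Sum>v\<in>vertices G. l {v}) - l (vertices G)"

definition orientation_of :: "('v, 'e) pre_digraph \<Rightarrow> ('v, 'e) multigraph \<Rightarrow> bool" where
  "orientation_of D G \<longleftrightarrow>
     verts D = vertices G \<and> arcs D = edges G \<and>
     (\<forall>e\<in>edges G. {tail D e, head D e} = ends G e)"

definition set_in_degree :: "('v, 'e) pre_digraph \<Rightarrow> 'v set \<Rightarrow> nat" where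
  "set_in_degree D A = card {e \<in> arcs D. tail D e \<notin> A \<and> head D e \<in> A}"

definition arc_connected :: "('v set \<Rightarrow> int) \<Rightarrow> ('v, 'e) pre_digraph \<Rightarrow> bool" where
  "arc_connected l D \<longleftrightarrow> (\<forall>A\<subseteq>verts D. l A \<le> int (set_in_degree D A))"

end

theory Submission
  imports Defs
begin

text \<open>
  In an orientation, the arcs with head in \<open>A\<close> either enter \<open>A\<close> or lie inside \<open>A\<close>, so
  the in-degree of \<open>A\<close> is the sum of the in-degrees of its vertices minus the number of edges
  induced by \<open>A\<close>. Once the in-degrees are prescribed by \<open>l\<close>, arc-connectivity is therefore the
  same as the sparsity condition. The remaining point is Hakimi's theorem: an orientation with
  in-degrees at most \<open>m\<close> exists if every \<open>X\<close> induces at most \<open>m(X)\<close> edges. It holds for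
  hypergraphs, whose edges are oriented one at a time. If no end \<open>w\<close> of the edge \<open>e\<close> could be
  chosen as its head, each \<open>w\<close> would lie in a set that is tight for the other edges; the union of
  these sets is again tight and contains \<open>e\<close>, so it would induce too many edges.
\<close>

definition induced_edges :: "('e \<Rightarrow> 'v set) \<Rightarrow> 'e set \<Rightarrow> 'v set \<Rightarrow> 'e set" where
  "induced_edges inc E X = {e \<in> E. inc e \<subseteq> X}"

definition sparse_on :: "'v set \<Rightarrow> ('v \<Rightarrow> int) \<Rightarrow> ('e \<Rightarrow> 'v set) \<Rightarrow> 'e set \<Rightarrow> bool" where
  "sparse_on V m inc E \<longleftrightarrow> (\<forall>X\<subseteq>V. int (card (induced_edges inc E X)) \<le> sum m X)"

definition tight_set :: "('v \<Rightarrow> int) \<Rightarrow> ('e \<Rightarrow> 'v set) \<Rightarrow> 'e set \<Rightarrow> 'v set \<Rightarrow> bool" where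
  "tight_set m inc E X \<longleftrightarrow> int (card (induced_edges inc E X)) = sum m X"

lemma sparse_onD:
  "sparse_on V m inc E \<Longrightarrow> X \<subseteq> V \<Longrightarrow> int (card (induced_edges inc E X)) \<le> sum m X"
  by (simp add: sparse_on_def)

lemma finite_induced_edges: "finite E \<Longrightarrow> finite (induced_edges inc E X)"
  by (simp add: induced_edges_def)

lemma card_induced_edges_insert:
  assumes "finite E" "e \<notin> E"
  shows "card (induced_edges inc (insert e E) X) =
    card (induced_edges inc E X) + of_bool (inc e \<subseteq> X)"
proof -
  have "induced_edges inc (insert e E) X =
      (if inc e \<subseteq> X then insert e (induced_edges inc E X) else induced_edges inc E X)"
    by (auto simp: induced_edges_def)
  moreover have "e \<notin> induced_edges inc E X"
    using assms by (simp add: induced_edges_def)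
  ultimately show ?thesis
    using assms by (simp add: finite_induced_edges)
qed

lemma card_induced_edges_supermodular:
  assumes "finite E"
  shows "card (induced_edges inc E X) + card (induced_edges inc E Y) \<le>
    card (induced_edges inc E (X \<union> Y)) + card (induced_edges inc E (X \<inter> Y))"
proof -
  let ?I = "induced_edges inc E"
  have "card (?I X) + card (?I Y) = card (?I X \<union> ?I Y) + card (?I X \<inter> ?I Y)"
    using assms by (intro card_Un_Int finite_induced_edges)
  moreover have "?I X \<inter> ?I Y = ?I (X \<inter> Y)"
    by (auto simp: induced_edges_def)
  moreover have "card (?I X \<union> ?I Y) \<le> card (?I (X \<union> Y))"
    using assms by (intro card_mono finite_induced_edges) (auto simp: induced_edges_def)
  ultimately show ?thesis by simp
qed

lemma sparse_on_subset:
  assumes "sparse_on V m inc F" "E \<subseteq> F" "finite F"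
  shows "sparse_on V m inc E"
  unfolding sparse_on_def
proof (intro allI impI)
  fix X assume "X \<subseteq> V"
  have "card (induced_edges inc E X) \<le> card (induced_edges inc F X)"
    using assms(2,3) by (intro card_mono finite_induced_edges) (auto simp: induced_edges_def)
  then show "int (card (induced_edges inc E X)) \<le> sum m X"
    using sparse_onD[OF assms(1) \<open>X \<subseteq> V\<close>] by linarith
qed

lemma tight_set_Un:
  assumes "finite V" "finite E" "sparse_on V m inc E"
    and "X \<subseteq> V" "Y \<subseteq> V" "tight_set m inc E X" "tight_set m inc E Y"
  shows "tight_set m inc E (X \<union> Y)"
proof -
  let ?c = "\<lambda>X. int (card (induced_edges inc E X))"
  have "finite X" "finite Y"
    using assms(1,4,5) finite_subset by blast+
  then have "sum m (X \<union> Y) + sum m (X \<inter> Y) = ?c X + ?c Y"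
    using assms(6,7) by (simp add: sum.union_inter tight_set_def)
  moreover have "?c X + ?c Y \<le> ?c (X \<union> Y) + ?c (X \<inter> Y)"
    using card_induced_edges_supermodular[OF assms(2), of inc X Y] by linarith
  moreover have "?c (X \<union> Y) \<le> sum m (X \<union> Y)" "?c (X \<inter> Y) \<le> sum m (X \<inter> Y)"
    using assms(4,5) by (intro sparse_onD[OF assms(3)]; blast)+
  ultimately show ?thesis by (simp add: tight_set_def)
qed

lemma tight_set_UN:
  assumes "finite V" "finite E" "sparse_on V m inc E"
    and "finite I" "\<And>i. i \<in> I \<Longrightarrow> T i \<subseteq> V" "\<And>i. i \<in> I \<Longrightarrow> tight_set m inc E (T i)"
  shows "tight_set m inc E (\<Union>i\<in>I. T i)"
  using assms(4-6)
proof (induction I rule: finite_induct)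
  case empty
  show ?case
    using sparse_onD[OF assms(3), of "{}"] by (simp add: tight_set_def)
next
  case (insert i I)
  have "tight_set m inc E (T i \<union> (\<Union>i\<in>I. T i))"
    using insert by (intro tight_set_Un[OF assms(1-3)]) auto
  then show ?case by simp
qed

lemma sparse_on_insert_imp_ex_head:
  assumes "finite V" "finite E" "e \<notin> E" "inc e \<subseteq> V" "sparse_on V m inc (insert e E)"
  shows "\<exists>w\<in>inc e. sparse_on V (\<lambda>v. m v - of_bool (v = w)) inc E"
proof (rule ccontr)
  assume no_head: "\<not> ?thesis"
  have sparse_E: "sparse_on V m inc E"
    using assms(2,5) by (auto intro: sparse_on_subset)
  have "\<exists>X\<subseteq>V. w \<in> X \<and> tight_set m inc E X" if w: "w \<in> inc e" for w
  proof -
    obtain X where X: "X \<subseteq> V"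
      "(\<Sum>v\<in>X. m v - of_bool (v = w)) < int (card (induced_edges inc E X))"
      using no_head w by (auto simp: sparse_on_def not_le)
    moreover have "(\<Sum>v\<in>X. m v - of_bool (v = w)) = sum m X - of_bool (w \<in> X)"
      using finite_subset[OF X(1) assms(1)] by (simp add: sum_subtractf of_bool_def)
    ultimately have "w \<in> X \<and> tight_set m inc E X"
      using sparse_onD[OF sparse_E X(1)] by (cases "w \<in> X") (auto simp: tight_set_def)
    with X(1) show ?thesis by blast
  qed
  then obtain T where T: "\<And>w. w \<in> inc e \<Longrightarrow> T w \<subseteq> V" "\<And>w. w \<in> inc e \<Longrightarrow> w \<in> T w"
    "\<And>w. w \<in> inc e \<Longrightarrow> tight_set m inc E (T w)"
    by metis
  define U where "U = (\<Union>w\<in>inc e. T w)"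
  have "tight_set m inc E U"
    unfolding U_def using finite_subset[OF assms(4,1)] T
    by (intro tight_set_UN[OF assms(1,2) sparse_E])
  moreover have "inc e \<subseteq> U"
    unfolding U_def using T(2) by blast
  ultimately have "int (card (induced_edges inc (insert e E) U)) = sum m U + 1"
    using card_induced_edges_insert[OF assms(2,3), of inc U] by (simp add: tight_set_def)
  moreover have "U \<subseteq> V"
    unfolding U_def using T(1) by blast
  ultimately show False
    using sparse_onD[OF assms(5), of U] by linarith
qed

theorem sparse_on_imp_ex_head_assignment:
  assumes "finite V" "finite E" "\<And>e. e \<in> E \<Longrightarrow> inc e \<subseteq> V" "sparse_on V m inc E"
  shows "\<exists>h. (\<forall>e\<in>E. h e \<in> inc e) \<and> (\<forall>v\<in>V. int (card {e \<in> E. h e = v}) \<le> m v)"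
  using assms(2-4)
proof (induction E arbitrary: m rule: finite_induct)
  case empty
  have "0 \<le> m v" if "v \<in> V" for v
    using sparse_onD[OF empty.prems(2), of "{v}"] that by (simp add: induced_edges_def)
  then show ?case by simp
next
  case (insert e E)
  obtain w where w: "w \<in> inc e" "sparse_on V (\<lambda>v. m v - of_bool (v = w)) inc E"
    using sparse_on_insert_imp_ex_head[OF assms(1) insert.hyps insert.prems(1)[OF insertI1]
        insert.prems(2)] by blast
  then obtain h where h: "\<forall>f\<in>E. h f \<in> inc f"
    "\<forall>v\<in>V. int (card {f \<in> E. h f = v}) \<le> m v - of_bool (v = w)"
    using insert.IH[OF insert.prems(1)[OF insertI2] w(2)] by blast
  have "{f \<in> insert e E. (h(e := w)) f = v} =
      (if v = w then insert e {f \<in> E. h f = v} else {f \<in> E. h f = v})" for v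
    using insert.hyps by auto
  then have "\<forall>v\<in>V. int (card {f \<in> insert e E. (h(e := w)) f = v}) \<le> m v"
    using h(2) insert.hyps by auto
  moreover have "\<forall>f\<in>insert e E. (h(e := w)) f \<in> inc f"
    using h(1) w(1) by simp
  ultimately show ?case by blast
qed

context fin_digraph
begin

lemma sum_in_degree:
  assumes "finite A"
  shows "(\<Sum>v\<in>A. in_degree G v) =
    set_in_degree G A + card {e \<in> arcs G. tail G e \<in> A \<and> head G e \<in> A}"
proof -
  let ?S = "{e \<in> arcs G. tail G e \<notin> A \<and> head G e \<in> A}"
  let ?I = "{e \<in> arcs G. tail G e \<in> A \<and> head G e \<in> A}"
  have "(\<Sum>v\<in>A. in_degree G v) = card (\<Union>v\<in>A. in_arcs G v)"
    unfolding in_degree_def using assms by (subst card_UN_disjoint) auto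
  also have "(\<Union>v\<in>A. in_arcs G v) = ?S \<union> ?I" by auto
  also have "card (?S \<union> ?I) = card ?S + card ?I"
    by (rule card_Un_disjoint) auto
  finally show ?thesis by (simp add: set_in_degree_def)
qed

lemma sum_in_degree_verts: "(\<Sum>v\<in>verts G. in_degree G v) = card (arcs G)"
proof -
  have "{e \<in> arcs G. tail G e \<notin> verts G \<and> head G e \<in> verts G} = {}"
    "{e \<in> arcs G. tail G e \<in> verts G \<and> head G e \<in> verts G} = arcs G"
    by auto
  then show ?thesis
    using sum_in_degree[OF finite_verts] by (simp only: set_in_degree_def card.empty add_0)
qed

end

context finite_multigraph
begin

lemma orientation_of_imp_fin_digraph:
  assumes "orientation_of D G"
  shows "fin_digraph D"
proof
  have D: "verts D = vertices G" "arcs D = edges G"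
    "\<And>e. e \<in> edges G \<Longrightarrow> {tail D e, head D e} = ends G e"
    using assms by (simp_all add: orientation_of_def)
  show "tail D e \<in> verts D" "head D e \<in> verts D" if "e \<in> arcs D" for e
    using that ends_subset[of e] D(3)[of e] unfolding D(1,2) by blast+
  show "finite (verts D)" "finite (arcs D)"
    using finite_vertices finite_edges D(1,2) by simp_all
qed

lemma sum_in_degree_orientation:
  assumes D: "orientation_of D G" and A: "A \<subseteq> vertices G"
  shows "(\<Sum>v\<in>A. in_degree D v) = set_in_degree D A + induced_edge_count G A"
proof -
  have "arcs D = edges G" "\<forall>e\<in>edges G. ends G e = {tail D e, head D e}"
    using D by (simp_all add: orientation_of_def)
  then have "{e \<in> arcs D. tail D e \<in> A \<and> head D e \<in> A} = {e \<in> edges G. ends G e \<subseteq> A}"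
    by auto
  then show ?thesis
    using fin_digraph.sum_in_degree[OF orientation_of_imp_fin_digraph[OF D]]
      finite_subset[OF A finite_vertices]
    by (simp add: induced_edge_count_def)
qed

lemma sum_in_degree_orientation_vertices:
  assumes "orientation_of D G"
  shows "(\<Sum>v\<in>vertices G. in_degree D v) = card (edges G)"
  using fin_digraph.sum_in_degree_verts[OF orientation_of_imp_fin_digraph[OF assms]] assms
  by (simp add: orientation_of_def)

lemma ex_orientation_with_heads:
  assumes "\<And>e. e \<in> edges G \<Longrightarrow> h e \<in> ends G e"
  shows "\<exists>D. orientation_of D G \<and> head D = h"
proof -
  have "\<exists>t. {t, h e} = ends G e" if e: "e \<in> edges G" for e
  proof -
    obtain u v where ends_e: "ends G e = {u, v}"
      using card_ends[OF e] by (auto simp: card_2_iff)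
    then have "h e = u \<or> h e = v"
      using assms[OF e] by simp
    then show ?thesis
      unfolding ends_e by (auto simp: insert_commute)
  qed
  then obtain t where t: "\<forall>e\<in>edges G. {t e, h e} = ends G e"
    using bchoice[of "edges G" "\<lambda>e t. {t, h e} = ends G e"] by blast
  let ?D = "\<lparr>verts = vertices G, arcs = edges G, tail = t, head = h\<rparr>"
  have "orientation_of ?D G"
    using t by (simp add: orientation_of_def)
  moreover have "head ?D = h" by simp
  ultimately show ?thesis by blast
qed

theorem ex_orientation_in_degree_eq:
  assumes sparse: "sparse_on (vertices G) m (ends G) (edges G)"
    and total: "int (card (edges G)) = sum m (vertices G)"
  shows "\<exists>D. orientation_of D G \<and> (\<forall>v\<in>vertices G. int (in_degree D v) = m v)"
proof -
  obtain h where h: "\<And>e. e \<in> edges G \<Longrightarrow> h e \<in> ends G e"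
    and h_le: "\<And>v. v \<in> vertices G \<Longrightarrow> int (card {e \<in> edges G. h e = v}) \<le> m v"
    using sparse_on_imp_ex_head_assignment[OF finite_vertices finite_edges ends_subset sparse]
    by blast
  obtain D where D: "orientation_of D G" "head D = h"
    using ex_orientation_with_heads[OF h] by blast
  then have in_degree_le: "\<forall>v\<in>vertices G. int (in_degree D v) \<le> m v"
    using h_le by (simp add: in_degree_def in_arcs_def orientation_of_def)
  have in_degree_total: "(\<Sum>v\<in>vertices G. int (in_degree D v)) = sum m (vertices G)"
    using sum_in_degree_orientation_vertices[OF D(1)] total by (simp flip: of_nat_sum)
  have "int (in_degree D v) = m v" if "v \<in> vertices G" for v
    using in_degree_le that finite_vertices by (intro sum_mono_inv[OF in_degree_total]) auto
  then show ?thesis using D(1) by blast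
qed

lemma arc_connected_iff_induced_edge_count_le:
  assumes D: "orientation_of D G"
  shows "arc_connected l D \<longleftrightarrow> (\<forall>X\<subseteq>vertices G.
    int (induced_edge_count G X) \<le> (\<Sum>v\<in>X. int (in_degree D v)) - l X)"
proof -
  have "l X \<le> int (set_in_degree D X) \<longleftrightarrow>
      int (induced_edge_count G X) \<le> (\<Sum>v\<in>X. int (in_degree D v)) - l X"
    if "X \<subseteq> vertices G" for X
    using sum_in_degree_orientation[OF D that] by (simp flip: of_nat_sum)
  moreover have "verts D = vertices G"
    using D by (simp add: orientation_of_def)
  ultimately show ?thesis by (auto simp: arc_connected_def)
qed

lemma minimally_rigid_iff_arc_connected:
  assumes D: "orientation_of D G" and degree: "\<forall>v\<in>vertices G. int (in_degree D v) = l {v}"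
    and "l (vertices G) = 0"
  shows "minimally_rigid l G \<longleftrightarrow> arc_connected l D"
proof -
  have degree_sum: "(\<Sum>v\<in>X. int (in_degree D v)) = (\<Sum>v\<in>X. l {v})" if "X \<subseteq> vertices G" for X
    using degree that by (intro sum.cong) auto
  have "int (card (edges G)) = (\<Sum>v\<in>vertices G. l {v}) - l (vertices G)"
    using sum_in_degree_orientation_vertices[OF D] degree_sum[OF subset_refl] assms(3)
    by (simp flip: of_nat_sum)
  then show ?thesis
    using degree_sum
    by (simp add: minimally_rigid_def arc_connected_iff_induced_edge_count_le[OF D])
qed

lemma minimally_rigid_imp_sparse_on:
  assumes "minimally_rigid l G" "\<And>A. A \<subseteq> vertices G \<Longrightarrow> 0 \<le> l A"
  shows "sparse_on (vertices G) (\<lambda>v. l {v}) (ends G) (edges G)"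
  unfolding sparse_on_def
proof (intro allI impI)
  fix X assume X: "X \<subseteq> vertices G"
  have "int (induced_edge_count G X) \<le> (\<Sum>v\<in>X. l {v}) - l X"
    using assms(1) X by (simp add: minimally_rigid_def)
  also have "\<dots> \<le> (\<Sum>v\<in>X. l {v})"
    using assms(2)[OF X] by simp
  finally show "int (card (induced_edges (ends G) (edges G) X)) \<le> (\<Sum>v\<in>X. l {v})"
    by (simp add: induced_edges_def induced_edge_count_def)
qed

end

theorem theorem7p2:
  fixes G :: "('v, 'e) multigraph" and l :: "'v set \<Rightarrow> int"
  assumes "finite_multigraph G"
    and "\<And>A. A \<subseteq> vertices G \<Longrightarrow> 0 \<le> l A"
    and "weakly_subadditive_on (vertices G) l"
    and "l {} = 0" and "l (vertices G) = 0"
  shows "minimally_rigid l G \<longleftrightarrow>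
    (\<exists>D. orientation_of D G \<and> arc_connected l D \<and>
         (\<forall>v\<in>vertices G. int (in_degree D v) = l {v}))"
proof -
  interpret finite_multigraph G by fact
  note rigid_iff = minimally_rigid_iff_arc_connected[of _ l, OF _ _ \<open>l (vertices G) = 0\<close>]
  show ?thesis
  proof
    assume rigid: "minimally_rigid l G"
    then have "int (card (edges G)) = (\<Sum>v\<in>vertices G. l {v})"
      using \<open>l (vertices G) = 0\<close> by (simp add: minimally_rigid_def)
    with minimally_rigid_imp_sparse_on[OF rigid assms(2)]
    obtain D where "orientation_of D G" "\<forall>v\<in>vertices G. int (in_degree D v) = l {v}"
      using ex_orientation_in_degree_eq by blast
    then show "\<exists>D. orientation_of D G \<and> arc_connected l D \<and>
        (\<forall>v\<in>vertices G. int (in_degree D v) = l {v})"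
      using rigid rigid_iff by blast
  next
    assume "\<exists>D. orientation_of D G \<and> arc_connected l D \<and>
        (\<forall>v\<in>vertices G. int (in_degree D v) = l {v})"
    then show "minimally_rigid l G"
      using rigid_iff by blast
  qed
qed

end
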